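(* For all integers $h\ge 2$ and $k\ge 2$, every deterministic thrifty $k$-way branching program solving $BT^h_2(k)$ has at least $k^h$ states.
   Context: Let $[k]=\{1,\dots,k\}$. $T^h_2$ is the balanced rooted binary tree with $h$ levels (height counts levels), nodes numbered heap-style: root $1$, children of node $i$ are $2i$ and $2i+1$. An instance with parameter $k$ assigns to each internal node $i$ a function $f_i:[k]^2\to[k]$ (given by its $k^2$ values) and to each leaf an element of $[k]$. Values: $v_i$ is the leaf label for a leaf, and $v_i=f_i(v_{2i},v_{2i+1})$ for an internal node. $BT^h_2(k)$ is the problem of deciding whether $v_1=1$. The $k$-ary input variables are $f_i(a,b)$ for internal $i$ and $a,b\in[k]$, plus one variable per leaf. A deterministic $k$-way branching program computing $g:[k]^m\to R$ is a directed rooted multigraph of states; each nonfinal state is labelled by a variable index in $[m]$ and has exactly $k$ outedges labelled $1,\dots,k$; there are $|R|$ final sink states labelled by elements of $R$; on input $x$ the computation starts at the root and from a state labelled $j$ follows the edge labelled $x_j$; it must reach the final state labelled $g(x)$. It solves a decision problem if it computes its characteristic function. Such a program solving $BT^h_2(k)$ is thrifty if, on every input, every query to a variable $f_i(a,b)$ of an internal node $i$ made during the computation satisfies $(a,b)=(v_{2i},v_{2i+1})$, the correct values of the children of $i$ on that input. *)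

theory Defs
  imports Main "HOL-Library.FuncSet"
begin

section \<open>Deterministic k-way branching programs\<close>

text \<open>
  The variables are indexed by an arbitrary set \<open>V\<close> (in place of \<open>{1..m}\<close>), so an input in
  \<open>[k]\<^sup>m\<close> is an element of \<open>V \<rightarrow>\<^sub>E {1..k}\<close>. Since every nonfinal state has exactly one outedge for
  each label in \<open>{1..k}\<close>, the edges of the multigraph are given by a successor function.
  The fields \<open>query_var\<close> and \<open>next_state\<close> matter only at nonfinal states,
  \<open>final_label\<close> only at final ones.
\<close>

record ('q, 'v, 'r) bp =
  states :: "'q set"
  start_state :: 'q
  final_states :: "'q set"
  query_var :: "'q \<Rightarrow> 'v"
  next_state :: "'q \<Rightarrow> nat \<Rightarrow> 'q"
  final_label :: "'q \<Rightarrow> 'r"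

definition inputs :: "'v set \<Rightarrow> nat \<Rightarrow> ('v \<Rightarrow> nat) set" where
  "inputs V k = V \<rightarrow>\<^sub>E {1..k}"

text \<open>Acyclicity and reachability of all states from the root are not required.\<close>

definition branching_program ::
    "nat \<Rightarrow> 'v set \<Rightarrow> 'r set \<Rightarrow> ('q, 'v, 'r) bp \<Rightarrow> bool" where
  "branching_program k V R B \<longleftrightarrow>
     finite (states B) \<and> start_state B \<in> states B \<and> final_states B \<subseteq> states B \<and>
     bij_betw (final_label B) (final_states B) R \<and>
     (\<forall>q \<in> states B - final_states B.
        query_var B q \<in> V \<and> (\<forall>a \<in> {1..k}. next_state B q a \<in> states B))"

text \<open>\<open>visits B x q\<close>: the computation of \<open>B\<close> on input \<open>x\<close> passes through state \<open>q\<close>.\<close>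

inductive visits :: "('q, 'v, 'r) bp \<Rightarrow> ('v \<Rightarrow> nat) \<Rightarrow> 'q \<Rightarrow> bool" for B x where
  start: "visits B x (start_state B)"
| step: "visits B x q \<Longrightarrow> q \<notin> final_states B \<Longrightarrow> visits B x (next_state B q (x (query_var B q)))"

definition computes ::
    "nat \<Rightarrow> 'v set \<Rightarrow> 'r set \<Rightarrow> ('q, 'v, 'r) bp \<Rightarrow> (('v \<Rightarrow> nat) \<Rightarrow> 'r) \<Rightarrow> bool" where
  "computes k V R B g \<longleftrightarrow>
     branching_program k V R B \<and>
     (\<forall>x \<in> inputs V k. \<exists>q \<in> final_states B. visits B x q \<and> final_label B q = g x)"

definition solves_decision ::
    "nat \<Rightarrow> 'v set \<Rightarrow> ('q, 'v, nat) bp \<Rightarrow> (('v \<Rightarrow> nat) \<Rightarrow> bool) \<Rightarrow> bool" where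
  "solves_decision k V B P \<longleftrightarrow> computes k V {0, 1} B (\<lambda>x. if P x then 1 else 0)"


section \<open>The tree evaluation problem on the balanced binary tree\<close>

definition internal_nodes :: "nat \<Rightarrow> nat set" where
  "internal_nodes h = {1..<2 ^ (h - 1)}"

definition leaf_nodes :: "nat \<Rightarrow> nat set" where
  "leaf_nodes h = {2 ^ (h - 1)..<2 ^ h}"

text \<open>\<open>Fun i a b\<close> is the variable holding \<open>f\<^sub>i(a, b)\<close>; \<open>Leaf i\<close> is the label of leaf \<open>i\<close>.\<close>

datatype tree_var = Fun nat nat nat | Leaf nat

definition tree_vars :: "nat \<Rightarrow> nat \<Rightarrow> tree_var set" where
  "tree_vars h k =
     {Fun i a b | i a b. i \<in> internal_nodes h \<and> a \<in> {1..k} \<and> b \<in> {1..k}} \<union>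
     Leaf ` leaf_nodes h"

text \<open>
  \<open>node_val h x i\<close> is \<open>v\<^sub>i\<close> on input \<open>x\<close>; it is meaningful only for nodes
  \<open>1 \<le> i < 2 ^ h\<close>, \<open>h \<ge> 1\<close>.
\<close>

function node_val :: "nat \<Rightarrow> (tree_var \<Rightarrow> nat) \<Rightarrow> nat \<Rightarrow> nat" where
  "node_val h x i =
     (if i \<in> internal_nodes h
      then x (Fun i (node_val h x (2 * i)) (node_val h x (2 * i + 1)))
      else x (Leaf i))"
  by pat_completeness auto
termination
proof (relation "measure (\<lambda>(h, x, i). 2 ^ h - i)")
  have lt: "i < 2 ^ h" if "i \<in> internal_nodes h" for i h :: nat
  proof -
    have "(2::nat) ^ (h - 1) \<le> 2 ^ h" by (rule power_increasing) auto
    moreover have "i < 2 ^ (h - 1)" using that unfolding internal_nodes_def by auto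
    ultimately show ?thesis by (rule less_le_trans[rotated])
  qed
  have pos: "0 < i" if "i \<in> internal_nodes h" for i h :: nat
    using that by (simp add: internal_nodes_def)
  show "((h, x, 2 * i), h, x, i) \<in> measure (\<lambda>(h, x, i). 2 ^ h - i)"
    if "i \<in> internal_nodes h" for h i :: nat and x :: "tree_var \<Rightarrow> nat"
    using lt[OF that] pos[OF that] by simp
  show "((h, x, 2 * i + 1), h, x, i) \<in> measure (\<lambda>(h, x, i). 2 ^ h - i)"
    if "i \<in> internal_nodes h" for h i :: nat and x :: "tree_var \<Rightarrow> nat"
    using lt[OF that] pos[OF that] by simp
qed simp

declare node_val.simps [simp del]

definition BT :: "nat \<Rightarrow> (tree_var \<Rightarrow> nat) \<Rightarrow> bool" where
  "BT h x \<longleftrightarrow> node_val h x 1 = 1"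

definition thrifty :: "nat \<Rightarrow> nat \<Rightarrow> ('q, tree_var, 'r) bp \<Rightarrow> bool" where
  "thrifty h k B \<longleftrightarrow>
     (\<forall>x \<in> inputs (tree_vars h k) k. \<forall>q i a b.
        visits B x q \<and> q \<notin> final_states B \<and> query_var B q = Fun i a b \<longrightarrow>
        a = node_val h x (2 * i) \<and> b = node_val h x (2 * i + 1))"

end

theory Submission
  imports Defs
begin

text \<open>
  Every assignment \<open>v\<close> of values to the nodes comes from an input whose functions are constant
  away from the correct arguments, and on these inputs a thrifty program sees nothing but \<open>v\<close>.
  Call a node pebbled at time \<open>t\<close> if, from \<open>t\<close> on, its parent is queried before the node itself
  is queried again. A query of a node must be preceded by queries of its children, so the
  computation is a pebbling of the tree and at some time at least \<open>h\<close> nodes are pebbled.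
  Continuing from the state reached at that time, the labels of the queries reveal the values of
  these \<open>h\<close> nodes before they are read; hence a given state is chosen by at most a fraction
  \<open>k\<^sup>-\<^sup>h\<close> of the assignments.
\<close>

section \<open>Pebbling the binary tree\<close>

definition pebbled :: "nat \<Rightarrow> (nat \<Rightarrow> nat) \<Rightarrow> nat \<Rightarrow> nat set" where
  "pebbled h n t = {j \<in> {2..<2 ^ h}. \<exists>s\<ge>t. n s = j div 2 \<and> (\<forall>s'\<in>{t..s}. n s' \<noteq> j)}"

text \<open>Halving climbs the heap towards the root, so these are the descendants of
  \<open>i\<close>, itself included. Intersecting with \<open>pebbled\<close> supplies the depth
  bound.\<close>

definition subtree :: "nat \<Rightarrow> nat set" where
  "subtree i = {j. \<exists>m. j div 2 ^ m = i}"

lemma finite_pebbled [simp]: "finite (pebbled h n t)"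
  by (simp add: pebbled_def)

lemma self_in_subtree: "i \<in> subtree i"
  unfolding subtree_def by (auto intro: exI[of _ 0])

lemma subtree_child:
  assumes "c div 2 = i"
  shows "subtree c \<subseteq> subtree i"
proof
  fix j assume "j \<in> subtree c"
  then obtain m where "j div 2 ^ m = c" by (auto simp: subtree_def)
  then have "j div 2 ^ Suc m = i"
    using assms by (metis div_mult2_eq power_Suc2)
  then show "j \<in> subtree i" unfolding subtree_def by blast
qed

lemma subtree_siblings_disjoint:
  assumes "i \<ge> 1"
  shows "subtree (2 * i) \<inter> subtree (2 * i + 1) = {}"
proof -
  \<comment> \<open>A higher ancestor is at most half of a lower one; siblings are too close for
    that.\<close>
  have less: "j div 2 ^ m' \<le> (j div 2 ^ m) div 2" if "m < m'" for j m m' :: nat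
  proof -
    have "j div 2 ^ m' \<le> j div 2 ^ Suc m"
      using that by (intro div_le_mono2 power_increasing) auto
    then show ?thesis by (metis div_mult2_eq power_Suc2)
  qed
  have False if "j div 2 ^ m = 2 * i" "j div 2 ^ m' = 2 * i + 1" for j m m'
    using less[of m m' j] less[of m' m j] that assms
    by (cases m m' rule: linorder_cases) auto
  then show ?thesis unfolding subtree_def by blast
qed

text \<open>At the last time when one of \<open>f\<close>, \<open>g\<close> is at least \<open>d\<close>, the other cannot vanish.\<close>

lemma simultaneous_large:
  fixes f g :: "nat \<Rightarrow> nat"
  assumes "a \<le> e" "d \<ge> 1" "f a = 0"
    and f: "\<And>t. t \<in> {a..e} \<Longrightarrow> f t = 0 \<Longrightarrow> \<exists>t'\<in>{t..e}. f t' \<ge> d"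
    and g: "\<And>t. t \<in> {a..e} \<Longrightarrow> g t = 0 \<Longrightarrow> \<exists>t'\<in>{t..e}. g t' \<ge> d"
  shows "\<exists>t\<in>{a..e}. f t + g t \<ge> Suc d"
proof -
  let ?T = "{t \<in> {a..e}. f t \<ge> d \<or> g t \<ge> d}"
  define m where "m = Max ?T"
  obtain t0 where "t0 \<in> {a..e}" "f t0 \<ge> d" using f[of a] assms(1,3) by auto
  then have "?T \<noteq> {}" by blast
  then have m: "m \<in> ?T" unfolding m_def by (intro Max_in) auto
  have max: "t \<le> m" if "t \<in> ?T" for t
    unfolding m_def using that by (intro Max_ge) auto
  have "f m \<noteq> 0"
  proof
    assume "f m = 0"
    then obtain t where "t \<in> {m..e}" "f t \<ge> d" using f[of m] m by auto
    then show False using max[of t] m \<open>f m = 0\<close> \<open>d \<ge> 1\<close> by auto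
  qed
  moreover have "g m \<noteq> 0"
  proof
    assume "g m = 0"
    then obtain t where "t \<in> {m..e}" "g t \<ge> d" using g[of m] m by auto
    then show False using max[of t] m \<open>g m = 0\<close> \<open>d \<ge> 1\<close> by auto
  qed
  ultimately show ?thesis using m by (intro bexI[of _ m]) auto
qed

text \<open>The parent query that witnesses the pebble at \<open>e\<close> also witnesses it at
  \<open>a\<close>. Contrapositively, a pebble appears on a node only through a query of that
  node.\<close>

lemma pebbled_persists:
  assumes "j \<in> pebbled h n e" "a \<le> e" "\<And>t. t \<in> {a..<e} \<Longrightarrow> n t \<noteq> j"
  shows "j \<in> pebbled h n a"
proof -
  obtain s where "s \<ge> e" "n s = j div 2" "\<forall>s'\<in>{e..s}. n s' \<noteq> j" "j \<in> {2..<2 ^ h}"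
    using assms(1) by (auto simp: pebbled_def)
  then show ?thesis using assms(2,3) unfolding pebbled_def
    by (auto intro!: exI[of _ s]) (metis atLeastAtMost_iff atLeastLessThan_iff not_le)
qed

lemma pebbled_at_parent_query:
  assumes "n e = j div 2" "j \<in> {2..<2 ^ h}"
  shows "j \<in> pebbled h n e"
proof -
  have "j div 2 \<noteq> j" using assms(2) by auto
  then have "e \<le> e \<and> n e = j div 2 \<and> (\<forall>s'\<in>{e..e}. n s' \<noteq> j)" using assms(1) by simp
  then show ?thesis unfolding pebbled_def using assms(2) by blast
qed

text \<open>At the query of \<open>i\<close> both children are pebbled, so each child subtree must
  build up \<open>Suc d\<close> pebbles from none; \<open>simultaneous_large\<close> finds a time
  when the other one is nonempty too. The bound on \<open>(i + 1) * 2 ^ Suc d\<close> says that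
  \<open>i\<close> has \<open>Suc d\<close> full levels below it. The induction hypothesis is a
  premise because the root, which never gets a pebble, needs this step as well.\<close>

lemma many_pebbled_below_query:
  assumes IH: "\<And>c a e. c \<ge> 1 \<Longrightarrow> (c + 1) * 2 ^ d \<le> 2 ^ h \<Longrightarrow> a \<le> e \<Longrightarrow>
        pebbled h n a \<inter> subtree c = {} \<Longrightarrow> c \<in> pebbled h n e \<Longrightarrow>
        \<exists>t\<in>{a..e}. card (pebbled h n t \<inter> subtree c) \<ge> Suc d"
    and i: "i \<ge> 1" "(i + 1) * 2 ^ Suc d \<le> 2 ^ h"
    and e: "a \<le> e" "n e = i"
    and empty: "pebbled h n a \<inter> subtree i = {}"
  shows "\<exists>t\<in>{a..e}. card (pebbled h n t \<inter> subtree i) \<ge> Suc (Suc d)"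
proof -
  define f where "f t = card (pebbled h n t \<inter> subtree (2 * i))" for t
  define g where "g t = card (pebbled h n t \<inter> subtree (2 * i + 1))" for t
  have le: "(2 * i + 2) * 2 ^ d \<le> 2 ^ h" using i(2) by (simp add: algebra_simps)
  have "(2 * i + 2) * 1 \<le> (2 * i + 2) * 2 ^ d" by (rule mult_le_mono2) simp
  then have lt: "2 * i + 2 \<le> 2 ^ h" using le by simp
  have le': "(2 * i + 1) * 2 ^ d \<le> 2 ^ h"
    using le by (rule order_trans[rotated]) (rule mult_le_mono1, simp)
  have peb: "2 * i \<in> pebbled h n e" "2 * i + 1 \<in> pebbled h n e"
    using i(1) lt e(2) by (auto intro!: pebbled_at_parent_query)
  have sub: "subtree (2 * i) \<subseteq> subtree i" "subtree (2 * i + 1) \<subseteq> subtree i"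
    by (auto intro!: subtree_child)
  have "\<exists>t\<in>{a..e}. f t + g t \<ge> Suc (Suc d)"
  proof (rule simultaneous_large)
    show "f a = 0" using empty sub by (auto simp: f_def)
    show "\<exists>t'\<in>{t..e}. f t' \<ge> Suc d" if "t \<in> {a..e}" "f t = 0" for t
      using IH[of "2 * i" t e] that peb i(1) le' by (auto simp: f_def)
    show "\<exists>t'\<in>{t..e}. g t' \<ge> Suc d" if "t \<in> {a..e}" "g t = 0" for t
      using IH[of "2 * i + 1" t e] that peb i(1) le by (auto simp: g_def)
  qed (use e in auto)
  then obtain t where t: "t \<in> {a..e}" "f t + g t \<ge> Suc (Suc d)" by blast
  have "f t + g t = card (pebbled h n t \<inter> (subtree (2 * i) \<union> subtree (2 * i + 1)))"
    unfolding f_def g_def Int_Un_distrib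
    by (rule card_Un_disjoint[symmetric]) (use subtree_siblings_disjoint[OF i(1)] in auto)
  also have "\<dots> \<le> card (pebbled h n t \<inter> subtree i)"
    using sub by (intro card_mono) auto
  finally show ?thesis using t by (intro bexI[of _ t]) auto
qed

lemma many_pebbled_in_subtree:
  assumes "i \<ge> 1" "(i + 1) * 2 ^ d \<le> 2 ^ h" "a \<le> e"
    "pebbled h n a \<inter> subtree i = {}" "i \<in> pebbled h n e"
  shows "\<exists>t\<in>{a..e}. card (pebbled h n t \<inter> subtree i) \<ge> Suc d"
  using assms
proof (induction d arbitrary: i a e)
  case 0
  then have "pebbled h n e \<inter> subtree i \<noteq> {}" using self_in_subtree by auto
  then have "card (pebbled h n e \<inter> subtree i) \<noteq> 0" by (simp add: card_eq_0_iff)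
  then have "Suc 0 \<le> card (pebbled h n e \<inter> subtree i)" by linarith
  then show ?case using 0 by (intro bexI[of _ e]) simp_all
next
  case (Suc d)
  \<comment> \<open>Being pebbled at \<open>e\<close> but not at \<open>a\<close>, the node
    \<open>i\<close> is queried in between.\<close>
  have "i \<notin> pebbled h n a" using Suc.prems(4) self_in_subtree by auto
  then obtain e' where e': "e' \<in> {a..<e}" "n e' = i"
    using pebbled_persists[OF Suc.prems(5,3)] by blast
  have "\<exists>t\<in>{a..e'}. card (pebbled h n t \<inter> subtree i) \<ge> Suc (Suc d)"
    using e' Suc.prems by (intro many_pebbled_below_query Suc.IH) auto
  then show ?case using e' by fastforce
qed

lemma tree_pebbling_bound:
  assumes "h \<ge> 2" "pebbled h n 0 = {}" "n e = 1"
  shows "\<exists>t. card (pebbled h n t) \<ge> h"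
proof -
  \<comment> \<open>For the root, \<open>(1 + 1) * 2 ^ Suc d\<close> is exactly
    \<open>2 ^ h\<close>.\<close>
  obtain d where d: "h = Suc (Suc d)" using assms(1) by (metis Suc_le_D numeral_2_eq_2 Suc_le_mono)
  have "\<exists>t\<in>{0..e}. card (pebbled h n t \<inter> subtree 1) \<ge> Suc (Suc d)"
    using assms by (intro many_pebbled_below_query many_pebbled_in_subtree) (auto simp: d)
  then obtain t where "h \<le> card (pebbled h n t \<inter> subtree 1)" using d by auto
  also have "\<dots> \<le> card (pebbled h n t)" by (intro card_mono) auto
  finally show ?thesis by blast
qed

section \<open>Thrifty computations seen on node values\<close>

fun queried_node :: "tree_var \<Rightarrow> nat" where
  "queried_node (Fun i a b) = i"
| "queried_node (Leaf i) = i"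

fun queried_children :: "tree_var \<Rightarrow> nat set" where
  "queried_children (Fun i a b) = {2 * i, 2 * i + 1}"
| "queried_children (Leaf i) = {}"

definition assignments :: "nat \<Rightarrow> nat \<Rightarrow> (nat \<Rightarrow> nat) set" where
  "assignments h k = {1..<2 ^ h} \<rightarrow>\<^sub>E {1..k}"

definition input_of :: "nat \<Rightarrow> nat \<Rightarrow> (nat \<Rightarrow> nat) \<Rightarrow> tree_var \<Rightarrow> nat" where
  "input_of h k v = restrict
     (\<lambda>x. case x of Leaf i \<Rightarrow> v i
        | Fun i a b \<Rightarrow> if a = v (2 * i) \<and> b = v (2 * i + 1) then v i else 1)
     (tree_vars h k)"

text \<open>Reading from \<open>v\<close> itself keeps inputs out of the counting;
  \<open>step_on_eq\<close> links this to the program. Final states are fixed points, so iteration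
  never breaks off.\<close>

definition step_on :: "('q, tree_var, 'r) bp \<Rightarrow> (nat \<Rightarrow> nat) \<Rightarrow> 'q \<Rightarrow> 'q" where
  "step_on B v q =
     (if q \<in> final_states B then q else next_state B q (v (queried_node (query_var B q))))"

text \<open>What well-formedness and thriftiness say about a state reached on
  \<open>input_of h k v\<close>, phrased through \<open>v\<close> alone.\<close>

definition consistent :: "nat \<Rightarrow> nat \<Rightarrow> ('q, tree_var, 'r) bp \<Rightarrow> (nat \<Rightarrow> nat) \<Rightarrow> 'q \<Rightarrow> bool" where
  "consistent h k B v q \<longleftrightarrow> q \<in> final_states B \<or>
     (query_var B q \<in> tree_vars h k \<and>
      (\<forall>i a b. query_var B q = Fun i a b \<longrightarrow> a = v (2 * i) \<and> b = v (2 * i + 1)))"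

text \<open>
  The nodes outside \<open>K\<close> whose values are first revealed by the label of a state
  (rather than by reading them) within \<open>n\<close> steps from \<open>q\<close>.
\<close>

primrec guessed :: "('q, tree_var, 'r) bp \<Rightarrow> (nat \<Rightarrow> nat) \<Rightarrow> nat \<Rightarrow> 'q \<Rightarrow> nat set \<Rightarrow> nat set" where
  "guessed B v 0 q K = {}"
| "guessed B v (Suc n) q K =
     (if q \<in> final_states B then {}
      else (queried_children (query_var B q) - K) \<union>
        guessed B v n (step_on B v q)
          (insert (queried_node (query_var B q)) (K \<union> queried_children (query_var B q))))"

lemma finite_queried_children [simp]: "finite (queried_children x)"
  by (cases x) auto

lemma finite_guessed [simp]: "finite (guessed B v n q K)"
  by (induction n arbitrary: q K) auto

lemma power_two_Suc_pred: "h \<ge> 1 \<Longrightarrow> (2::nat) ^ h = 2 * 2 ^ (h - 1)"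
  by (cases h) auto

lemma queried_in_nodes:
  assumes "h \<ge> 1" "x \<in> tree_vars h k"
  shows "queried_node x \<in> {1..<2 ^ h}" "queried_children x \<subseteq> {1..<2 ^ h}"
  using assms power_two_Suc_pred[OF assms(1)]
  by (auto simp: tree_vars_def internal_nodes_def leaf_nodes_def intro: order_trans[rotated])

lemma funpow_step_on_final: "q \<in> final_states B \<Longrightarrow> (step_on B v ^^ s) q = q"
  by (induction s) (auto simp: step_on_def)

text \<open>A node enters the known set only by being queried or as a child of a queried node. The
  former is excluded before time \<open>s\<close>, so the first label showing \<open>j\<close> as a
  child guesses it.\<close>

lemma guessed_witness:
  assumes "s < n" "j \<notin> K"
    "(step_on B v ^^ s) q \<notin> final_states B"
    "j \<in> queried_children (query_var B ((step_on B v ^^ s) q))"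
    "\<And>s'. s' < s \<Longrightarrow> queried_node (query_var B ((step_on B v ^^ s') q)) \<noteq> j"
  shows "j \<in> guessed B v n q K"
  using assms
proof (induction n arbitrary: q K s)
  case (Suc n)
  have nf: "q \<notin> final_states B"
    using Suc.prems(3) funpow_step_on_final by metis
  show ?case
  proof (cases "s = 0 \<or> j \<in> queried_children (query_var B q)")
    case True
    then show ?thesis using nf Suc.prems by auto
  next
    case False
    then obtain s0 where s: "s = Suc s0" by (cases s) auto
    have "j \<in> guessed B v n (step_on B v q)
        (insert (queried_node (query_var B q)) (K \<union> queried_children (query_var B q)))"
    proof (rule Suc.IH[of s0])
      show "j \<notin> insert (queried_node (query_var B q)) (K \<union> queried_children (query_var B q))"
        using Suc.prems(2) Suc.prems(5)[of 0] False s by auto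
      show "queried_node (query_var B ((step_on B v ^^ s') (step_on B v q))) \<noteq> j" if "s' < s0" for s'
        using Suc.prems(5)[of "Suc s'"] that s by (simp add: funpow_swap1)
    qed (use Suc.prems s in \<open>auto simp: funpow_swap1\<close>)
    then show ?thesis using nf by simp
  qed
qed simp

section \<open>Counting assignments by their guesses\<close>

lemma card_assignments: "card (assignments h k) = k ^ (2 ^ h - 1)"
  by (simp add: assignments_def card_PiE)

lemma finite_assignments [simp]: "finite (assignments h k)"
  by (auto simp: assignments_def intro: finite_PiE)

text \<open>Restriction to the nodes outside \<open>K\<close> is injective here, leaving
  \<open>2 ^ h - 1 - card K\<close> free values.\<close>

lemma card_assignments_extending:
  assumes "K \<subseteq> {1..<2 ^ h}"
  shows "card {v \<in> assignments h k. \<forall>j\<in>K. v j = w j} * k ^ card K \<le> k ^ (2 ^ h - 1)"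
proof -
  let ?N = "{1..<2 ^ h} :: nat set"
  let ?V = "{v \<in> assignments h k. \<forall>j\<in>K. v j = w j}"
  have fin: "finite K" using assms finite_subset by blast
  have "inj_on (\<lambda>v. restrict v (?N - K)) ?V"
  proof (rule inj_onI)
    fix u v assume uv: "u \<in> ?V" "v \<in> ?V" "restrict u (?N - K) = restrict v (?N - K)"
    show "u = v"
    proof
      fix j
      show "u j = v j"
      proof (cases "j \<in> ?N - K")
        case True
        then show ?thesis using fun_cong[OF uv(3), of j] by simp
      next
        case False
        then consider "j \<in> K" | "j \<notin> ?N" by blast
        then show ?thesis
        proof cases
          case 1
          then show ?thesis using uv(1,2) by simp
        next
          case 2
          have "u \<in> ?N \<rightarrow>\<^sub>E {1..k}" "v \<in> ?N \<rightarrow>\<^sub>E {1..k}"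
            using uv(1,2) by (simp_all add: assignments_def)
          then show ?thesis using PiE_arb[OF _ 2] by metis
        qed
      qed
    qed
  qed
  moreover have "(\<lambda>v. restrict v (?N - K)) ` ?V \<subseteq> (?N - K) \<rightarrow>\<^sub>E {1..k}"
    unfolding assignments_def by (auto intro!: restrict_PiE_iff[THEN iffD2])
  ultimately have "card ?V \<le> card ((?N - K) \<rightarrow>\<^sub>E {1..k})"
    by (rule card_inj_on_le) (auto intro: finite_PiE)
  also have "\<dots> = k ^ (2 ^ h - 1 - card K)"
    using assms fin by (simp add: card_PiE card_Diff_subset)
  finally have "card ?V * k ^ card K \<le> k ^ (2 ^ h - 1 - card K) * k ^ card K"
    by (rule mult_le_mono1)
  also have "\<dots> = k ^ (2 ^ h - 1)"
    using card_mono[OF _ assms] by (simp only: le_add_diff_inverse2 card_atLeastLessThan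
        finite_atLeastLessThan flip: power_add)
  finally show ?thesis .
qed

text \<open>
  Each guessed value comes for free and each value read costs a factor \<open>k\<close>, so \<open>g\<close> guesses
  confine the assignment to a fraction \<open>k\<^sup>-\<^sup>g\<close> of those that extend \<open>w\<close> on \<open>K\<close>.
\<close>

lemma card_guessing_assignments:
  assumes "h \<ge> 1" "k \<ge> 1" "K \<subseteq> {1..<2 ^ h}"
  shows "card {v \<in> assignments h k. (\<forall>j\<in>K. v j = w j) \<and>
           (\<forall>t. consistent h k B v ((step_on B v ^^ t) q)) \<and> g \<le> card (guessed B v n q K)}
         * k ^ (card K + g) \<le> k ^ (2 ^ h - 1)"
    (is "card (?S n q K w g) * _ \<le> _")
  using assms(3)
proof (induction n arbitrary: q K w g)
  case 0
  \<comment> \<open>Nothing is guessed, so the set is empty for \<open>g > 0\<close> and only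
    \<open>g = 0\<close> has content.\<close>
  have "card (?S 0 q K w 0) \<le> card {v \<in> assignments h k. \<forall>j\<in>K. v j = w j}"
    by (intro card_mono) auto
  then have "card (?S 0 q K w 0) * k ^ card K \<le> k ^ (2 ^ h - 1)"
    using card_assignments_extending[OF 0] by (meson mult_le_mono1 order_trans)
  then show ?case by (cases "g = 0") auto
next
  case (Suc n)
  let ?x = "query_var B q"
  let ?i = "queried_node ?x"
  let ?C = "queried_children ?x"
  let ?K' = "K \<union> ?C"
  have finK: "finite K" using Suc.prems finite_subset by blast
  show ?case
  proof (cases "q \<in> final_states B")
    case True
    have "card (?S (Suc n) q K w 0) \<le> card {v \<in> assignments h k. \<forall>j\<in>K. v j = w j}"
      by (intro card_mono) auto
    then have "card (?S (Suc n) q K w 0) * k ^ card K \<le> k ^ (2 ^ h - 1)"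
      using card_assignments_extending[OF Suc.prems] by (meson mult_le_mono1 order_trans)
    then show ?thesis using True by (cases "g = 0") auto
  next
    case nf: False
    show ?thesis
    proof (cases "?x \<in> tree_vars h k")
      case False
      then have "\<not> consistent h k B v ((step_on B v ^^ 0) q)" for v
        using nf by (simp add: consistent_def)
      then have empty: "?S (Suc n) q K w g = {}" by blast
      show ?thesis unfolding empty by simp
    next
      case True
      note nodes = queried_in_nodes[OF assms(1) True]
      define c where "c = card (?C - K)"
      \<comment> \<open>The label announces the child values: outside \<open>K\<close>, a consistent
        assignment takes \<open>a\<close> at \<open>2 * i\<close> and \<open>b\<close> at
        \<open>2 * i + 1\<close>.\<close>
      define w' where "w' = (\<lambda>j. if j \<in> K then w j else
        case ?x of Fun i a b \<Rightarrow> (if j = 2 * i then a else b) | Leaf i \<Rightarrow> w j)"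
      have cardK': "card ?K' = card K + c"
        using finK card_Un_disjoint[of K "?C - K"] by (simp add: c_def)
      have ext: "\<forall>j\<in>?K'. v j = w' j"
        if "\<forall>j\<in>K. v j = w j" "consistent h k B v q" for v
        using that nf by (cases ?x) (auto simp: w'_def consistent_def)
      \<comment> \<open>The assignments possible after reading \<open>d\<close>. Truncated
        subtraction covers labels that alone supply \<open>g\<close> guesses or more.\<close>
      define S where "S d = ?S n (next_state B q d) (insert ?i ?K') (w'(?i := d)) (g - c)" for d
      have S: "v \<in> S (v ?i)" if v: "v \<in> ?S (Suc n) q K w g" for v
      proof -
        have "consistent h k B v ((step_on B v ^^ 0) q)" using v by blast
        then have "\<forall>j\<in>?K'. v j = w' j" using ext v by simp
        moreover have "g \<le> c + card (guessed B v n (step_on B v q) (insert ?i ?K'))"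
          using v nf order_trans[OF _ card_Un_le] by (fastforce simp: c_def)
        moreover have "consistent h k B v ((step_on B v ^^ t) (step_on B v q))" for t
        proof -
          have "consistent h k B v ((step_on B v ^^ Suc t) q)" using v by blast
          then show ?thesis by (simp add: funpow_swap1)
        qed
        moreover have "step_on B v q = next_state B q (v ?i)" using nf by (simp add: step_on_def)
        ultimately show ?thesis using v by (auto simp: S_def)
      qed
      have bound: "card (S d) * k ^ (card (insert ?i ?K') + (g - c)) \<le> k ^ (2 ^ h - 1)" for d
        unfolding S_def using Suc.prems nodes by (intro Suc.IH) auto
      have finS: "finite (S d)" for d by (auto simp: S_def)
      show ?thesis
      proof (cases "?i \<in> ?K'")
        case True
        \<comment> \<open>The value read is already known, so all these assignments take the same
          edge.\<close>
        have "?S (Suc n) q K w g \<subseteq> S (w' ?i)"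
        proof
          fix v assume v: "v \<in> ?S (Suc n) q K w g"
          then have "consistent h k B v ((step_on B v ^^ 0) q)" by blast
          then have "v ?i = w' ?i" using ext[of v] v True by simp
          then show "v \<in> S (w' ?i)" using S[OF v] by simp
        qed
        then have "card (?S (Suc n) q K w g) \<le> card (S (w' ?i))"
          by (rule card_mono[OF finS])
        moreover have "k ^ (card K + g) \<le> k ^ (card (insert ?i ?K') + (g - c))"
          using assms(2) True cardK' by (intro power_increasing) (auto simp: insert_absorb)
        ultimately show ?thesis using bound[of "w' ?i"] by (meson mult_le_mono order_trans)
      next
        case False
        \<comment> \<open>The value read is new. There are \<open>k\<close> possible edges, but each
          successor knows one more node, and this extra factor \<open>k\<close> pays for the sum
          over \<open>d\<close>.\<close>
        have "?S (Suc n) q K w g \<subseteq> (\<Union>d\<in>{1..k}. S d)"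
        proof
          fix v assume v: "v \<in> ?S (Suc n) q K w g"
          then have "v ?i \<in> {1..k}" using nodes by (auto simp: assignments_def PiE_iff)
          then show "v \<in> (\<Union>d\<in>{1..k}. S d)" using S[OF v] by blast
        qed
        then have "card (?S (Suc n) q K w g) \<le> card (\<Union>d\<in>{1..k}. S d)"
          by (intro card_mono) (use finS in auto)
        also have "\<dots> \<le> (\<Sum>d\<in>{1..k}. card (S d))" by (rule card_UN_le) simp
        finally have le: "card (?S (Suc n) q K w g) \<le> (\<Sum>d\<in>{1..k}. card (S d))" .
        have "k ^ (card K + g + 1) \<le> k ^ (card (insert ?i ?K') + (g - c))"
          using assms(2) False cardK' finK by (intro power_increasing) auto
        then have "card (?S (Suc n) q K w g) * k ^ (card K + g + 1)
            \<le> (\<Sum>d\<in>{1..k}. card (S d)) * k ^ (card (insert ?i ?K') + (g - c))"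
          using le by (rule mult_le_mono[rotated])
        also have "\<dots> \<le> (\<Sum>d\<in>{1..k}. k ^ (2 ^ h - 1))"
          unfolding sum_distrib_right by (intro sum_mono bound)
        finally show ?thesis using assms(2) by simp
      qed
    qed
  qed
qed

section \<open>Inputs realising an assignment\<close>

lemma input_of_in_inputs:
  assumes "h \<ge> 1" "k \<ge> 1" "v \<in> assignments h k"
  shows "input_of h k v \<in> inputs (tree_vars h k) k"
proof -
  have "v i \<in> {1..k}" if "i \<in> {1..<2 ^ h}" for i
    using assms(3) that unfolding assignments_def by (rule PiE_mem)
  moreover have "x \<in> tree_vars h k \<Longrightarrow> queried_node x \<in> {1..<2 ^ h}" for x
    using queried_in_nodes assms(1) by blast
  ultimately show ?thesis
    using assms(2) unfolding inputs_def input_of_def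
    by (fastforce split: tree_var.split)
qed

text \<open>Induction from the leaves up, as children have larger numbers: correct child values
  select the one function entry set to \<open>v i\<close>.\<close>

lemma node_val_input_of:
  assumes "h \<ge> 1" "v \<in> assignments h k" "i \<in> {1..<2 ^ h}"
  shows "node_val h (input_of h k v) i = v i"
  using assms(3)
proof (induction "2 ^ h - i" arbitrary: i rule: less_induct)
  case less
  have val: "v j \<in> {1..k}" if "j \<in> {1..<2 ^ h}" for j
    using assms(2) that unfolding assignments_def by (rule PiE_mem)
  show ?case
  proof (cases "i \<in> internal_nodes h")
    case True
    then have ch: "2 * i \<in> {1..<2 ^ h}" "2 * i + 1 \<in> {1..<2 ^ h}"
      using power_two_Suc_pred[OF assms(1)] by (auto simp: internal_nodes_def)
    have "node_val h (input_of h k v) (2 * i) = v (2 * i)"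
      "node_val h (input_of h k v) (2 * i + 1) = v (2 * i + 1)"
      using ch less.prems by (auto intro!: less.hyps)
    moreover have "Fun i (v (2 * i)) (v (2 * i + 1)) \<in> tree_vars h k"
      using True val[OF ch(1)] val[OF ch(2)] by (auto simp: tree_vars_def)
    ultimately show ?thesis using True
      by (subst node_val.simps) (simp add: input_of_def)
  next
    case False
    then have "Leaf i \<in> tree_vars h k"
      using less.prems by (auto simp: tree_vars_def internal_nodes_def leaf_nodes_def)
    then show ?thesis using False
      by (subst node_val.simps) (simp add: input_of_def)
  qed
qed

section \<open>The run of a thrifty program on an assignment\<close>

locale thrifty_program =
  fixes h k :: nat and B :: "('q, tree_var, nat) bp"
  assumes h: "h \<ge> 2" and k: "k \<ge> 2"
    and solves: "solves_decision k (tree_vars h k) B (BT h)"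
    and thrifty: "thrifty h k B"
begin

abbreviation "state_at v t \<equiv> (step_on B v ^^ t) (start_state B)"

text \<open>The value 0, which is not a node, stands for a computation that has stopped.\<close>

definition "query_seq v t =
  (if state_at v t \<in> final_states B then 0 else queried_node (query_var B (state_at v t)))"

lemma program: "branching_program k (tree_vars h k) {0, 1} B"
  using solves unfolding solves_decision_def computes_def by blast

lemma visits_consistent:
  assumes v: "v \<in> assignments h k" and q: "visits B (input_of h k v) q" "q \<in> states B"
  shows "consistent h k B v q"
proof (cases "q \<in> final_states B")
  case False
  have var: "query_var B q \<in> tree_vars h k"
    using program q(2) False unfolding branching_program_def by blast
  have "a = v (2 * i) \<and> b = v (2 * i + 1)" if var_eq: "query_var B q = Fun i a b" for i a b
  proof -
    have "a = node_val h (input_of h k v) (2 * i) \<and> b = node_val h (input_of h k v) (2 * i + 1)"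
      using thrifty input_of_in_inputs[OF _ _ v] h k q(1) False var_eq unfolding thrifty_def by simp
    moreover have "2 * i \<in> {1..<2 ^ h}" "2 * i + 1 \<in> {1..<2 ^ h}"
      using queried_in_nodes(2)[of h "query_var B q" k] var h var_eq by auto
    ultimately show ?thesis using node_val_input_of[OF _ v] h by simp
  qed
  then show ?thesis using var by (simp add: consistent_def)
qed (simp add: consistent_def)

text \<open>A consistent label carries the correct child values, so the input returns the node value
  there and not the default 1.\<close>

lemma step_on_eq:
  assumes v: "v \<in> assignments h k" and q: "consistent h k B v q" "q \<notin> final_states B"
  shows "step_on B v q = next_state B q (input_of h k v (query_var B q))"
  using q by (cases "query_var B q") (auto simp: step_on_def consistent_def input_of_def)

text \<open>Both facts go through one induction: \<open>step_on_eq\<close> needs consistency, which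
  needs a visited state in \<open>states B\<close>.\<close>

lemma visits_state_at:
  assumes "v \<in> assignments h k"
  shows "visits B (input_of h k v) (state_at v t) \<and> state_at v t \<in> states B"
proof (induction t)
  case 0
  then show ?case using program visits.start by (auto simp: branching_program_def)
next
  case (Suc t)
  let ?q = "state_at v t"
  show ?case
  proof (cases "?q \<in> final_states B")
    case True
    then have "state_at v (Suc t) = ?q" by (simp add: step_on_def[of B v ?q])
    then show ?thesis using Suc by (simp only:)
  next
    case False
    have eq: "step_on B v ?q = next_state B ?q (input_of h k v (query_var B ?q))"
      using Suc False assms by (intro step_on_eq visits_consistent) auto
    have "query_var B ?q \<in> tree_vars h k"
      using program Suc False unfolding branching_program_def by blast
    then have "input_of h k v (query_var B ?q) \<in> {1..k}"
      using input_of_in_inputs[OF _ _ assms] h k unfolding inputs_def by (simp add: PiE_iff)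
    then have "next_state B ?q (input_of h k v (query_var B ?q)) \<in> states B"
      using program Suc False unfolding branching_program_def by blast
    then show ?thesis using eq Suc False visits.step by fastforce
  qed
qed

lemma consistent_state_at:
  "v \<in> assignments h k \<Longrightarrow> consistent h k B v (state_at v t)"
  using visits_consistent visits_state_at by blast

lemma visits_imp_state_at:
  assumes "v \<in> assignments h k" "visits B (input_of h k v) q"
  shows "\<exists>t. q = state_at v t"
  using assms(2)
proof induction
  case start
  then show ?case by (auto intro: exI[of _ 0])
next
  case (step q)
  then obtain t where t: "q = state_at v t" by blast
  then have "next_state B q (input_of h k v (query_var B q)) = state_at v (Suc t)"
    using step_on_eq[OF assms(1) consistent_state_at[OF assms(1)]] step.hyps(2) by simp
  then show ?case by blast
qed

lemma state_at_final:
  assumes "state_at v t \<in> final_states B" "t \<le> s"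
  shows "state_at v s = state_at v t"
  using assms(2,1) by (induction s rule: dec_induct) (auto simp: step_on_def)

lemma final_label_correct:
  assumes "v \<in> assignments h k"
  shows "\<exists>t. state_at v t \<in> final_states B \<and>
    final_label B (state_at v t) = (if v 1 = 1 then 1 else 0)"
proof -
  have "1 < (2::nat) ^ h" using h by (intro one_less_power) auto
  then have "BT h (input_of h k v) \<longleftrightarrow> v 1 = 1"
    using node_val_input_of[of h v k 1] assms h by (auto simp: BT_def)
  moreover have "input_of h k v \<in> inputs (tree_vars h k) k"
    using input_of_in_inputs assms h k by simp
  then obtain q where "q \<in> final_states B" "visits B (input_of h k v) q"
      "final_label B q = (if BT h (input_of h k v) then 1 else 0)"
    using solves unfolding solves_decision_def computes_def by blast
  ultimately show ?thesis using visits_imp_state_at[OF assms] by metis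
qed

section \<open>Changing the value of one node\<close>

lemma update_in_assignments:
  "v \<in> assignments h k \<Longrightarrow> j \<in> {1..<2 ^ h} \<Longrightarrow> c \<in> {1..k} \<Longrightarrow> v(j := c) \<in> assignments h k"
  unfolding assignments_def by (auto simp: PiE_iff extensional_def)

lemma state_at_update:
  assumes "j \<noteq> 0" "\<And>s. s < t \<Longrightarrow> query_seq v s \<noteq> j"
  shows "state_at (v(j := c)) t = state_at v t"
  using assms(2)
proof (induction t)
  case (Suc t)
  have "query_seq v t \<noteq> j" using Suc.prems by simp
  then have "step_on B (v(j := c)) (state_at v t) = step_on B v (state_at v t)"
    by (auto simp: step_on_def query_seq_def split: if_splits)
  moreover have "state_at (v(j := c)) t = state_at v t"
    by (rule Suc.IH) (rule Suc.prems, simp)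
  ultimately show ?case by (simp only: funpow.simps comp_apply)
qed simp

lemma root_queried:
  assumes "v \<in> assignments h k"
  shows "\<exists>e. query_seq v e = 1"
proof (rule ccontr)
  assume no: "\<nexists>e. query_seq v e = 1"
  \<comment> \<open>Exactly one of \<open>v 1\<close> and \<open>u 1\<close> is 1, so the two
    answers differ.\<close>
  define u where "u = v(1 := if v 1 = 1 then 2 else 1)"
  have "1 < (2::nat) ^ h" using h by (intro one_less_power) auto
  then have "u \<in> assignments h k"
    unfolding u_def using k by (intro update_in_assignments assms) auto
  moreover have "state_at u t = state_at v t" for t
    unfolding u_def using no by (intro state_at_update) auto
  ultimately obtain s t where
    s: "state_at v s \<in> final_states B"
      "final_label B (state_at v s) = (if v 1 = 1 then 1 else 0)" and
    t: "state_at v t \<in> final_states B"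
      "final_label B (state_at v t) = (if u 1 = 1 then 1 else 0)"
    using final_label_correct[OF assms] final_label_correct[of u] by metis
  \<comment> \<open>Final states are absorbing and the two runs coincide, so one final state would
    carry both answers.\<close>
  have "state_at v s = state_at v t"
    using state_at_final[OF s(1), of t] state_at_final[OF t(1), of s] by (cases "s \<le> t") auto
  then show False using s(2) t(2) by (auto simp: u_def split: if_splits)
qed

lemma parent_query_var:
  assumes v: "v \<in> assignments h k" and j: "j \<in> {2..<2 ^ h}" and s: "query_seq v s = j div 2"
  shows "state_at v s \<notin> final_states B"
    "\<exists>a b. query_var B (state_at v s) = Fun (j div 2) a b"
proof -
  have "j div 2 \<noteq> 0" using j by auto
  then show nf: "state_at v s \<notin> final_states B" using s by (auto simp: query_seq_def)
  then have node: "queried_node (query_var B (state_at v s)) = j div 2"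
    using s by (simp add: query_seq_def)
  have "query_var B (state_at v s) \<in> tree_vars h k"
    using consistent_state_at[OF v, of s] nf by (simp add: consistent_def)
  moreover have "j div 2 \<notin> leaf_nodes h"
    using j power_two_Suc_pred[of h] h by (auto simp: leaf_nodes_def)
  ultimately show "\<exists>a b. query_var B (state_at v s) = Fun (j div 2) a b"
    using node by (auto simp: tree_vars_def)
qed

text \<open>
  If a node were not queried before its parent, changing its value would not affect the
  computation up to the parent's query, whose arguments cannot fit both values.
\<close>

lemma initially_unpebbled:
  assumes v: "v \<in> assignments h k"
  shows "pebbled h (query_seq v) 0 = {}"
proof (rule ccontr)
  assume "pebbled h (query_seq v) 0 \<noteq> {}"
  then obtain j s where j: "j \<in> {2..<2 ^ h}" and s: "query_seq v s = j div 2"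
    and before: "\<And>s'. s' \<le> s \<Longrightarrow> query_seq v s' \<noteq> j"
    unfolding pebbled_def by auto
  define u where "u = v(j := if v j = 1 then 2 else 1)"
  have u: "u \<in> assignments h k"
    unfolding u_def using k j by (intro update_in_assignments v) auto
  have eq: "state_at u s = state_at v s"
    unfolding u_def using before j by (intro state_at_update) auto
  obtain a b where "state_at v s \<notin> final_states B" "query_var B (state_at v s) = Fun (j div 2) a b"
    using parent_query_var[OF v j s] by blast
  then have "u (2 * (j div 2)) = v (2 * (j div 2))" "u (2 * (j div 2) + 1) = v (2 * (j div 2) + 1)"
    using consistent_state_at[OF v, of s] consistent_state_at[OF u, of s] eq
    by (auto simp: consistent_def)
  then have "u j = v j" by (cases "even j") auto
  then show False by (auto simp: u_def split: if_splits)
qed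

text \<open>Starting at \<open>t\<close> with nothing known, the label of the parent's query names
  the value of a pebbled node before it is read. There are finitely many pebbles, so a common step
  bound exists.\<close>

lemma eventually_pebbled_guessed:
  assumes v: "v \<in> assignments h k"
  shows "eventually (\<lambda>n. pebbled h (query_seq v) t \<subseteq> guessed B v n (state_at v t) {}) sequentially"
proof -
  have "eventually (\<lambda>n. j \<in> guessed B v n (state_at v t) {}) sequentially"
    if peb: "j \<in> pebbled h (query_seq v) t" for j
  proof -
    obtain s where j: "j \<in> {2..<2 ^ h}" and s: "s \<ge> t" "query_seq v s = j div 2"
      and unq: "\<forall>s'\<in>{t..s}. query_seq v s' \<noteq> j"
      using peb unfolding pebbled_def by auto
    have shift: "(step_on B v ^^ r) (state_at v t) = state_at v (t + r)" for r
      by (simp add: funpow_add add.commute[of t])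
    note nf = parent_query_var(1)[OF v j s(2)]
    obtain a b where var_eq: "query_var B (state_at v s) = Fun (j div 2) a b"
      using parent_query_var(2)[OF v j s(2)] by blast
    have "j \<in> guessed B v n (state_at v t) {}" if n: "n > s" for n
    proof (rule guessed_witness[of "s - t"])
      show "(step_on B v ^^ (s - t)) (state_at v t) \<notin> final_states B"
        using nf s(1) by (simp add: shift)
      have "j \<in> {2 * (j div 2), 2 * (j div 2) + 1}" by auto
      then show "j \<in> queried_children (query_var B ((step_on B v ^^ (s - t)) (state_at v t)))"
        using var_eq s(1) by (simp only: shift le_add_diff_inverse queried_children.simps)
      fix s' assume s': "s' < s - t"
      \<comment> \<open>A run that had stopped could not query at time \<open>s\<close>; so
        \<open>query_seq\<close> shows a real query here, not the value 0.\<close>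
      have "state_at v (t + s') \<notin> final_states B"
      proof
        assume "state_at v (t + s') \<in> final_states B"
        then show False using state_at_final[of "t + s'" v s] nf s' by simp
      qed
      then show "queried_node (query_var B ((step_on B v ^^ s') (state_at v t))) \<noteq> j"
        using unq s' by (auto simp: shift query_seq_def dest: bspec[of _ _ "t + s'"])
    qed (use n s(1) in auto)
    then show ?thesis by (auto simp: eventually_sequentially intro!: exI[of _ "Suc s"])
  qed
  then have "eventually (\<lambda>n. \<forall>j\<in>pebbled h (query_seq v) t.
      j \<in> guessed B v n (state_at v t) {}) sequentially"
    by (intro eventually_ball_finite) auto
  then show ?thesis by (simp add: subset_eq)
qed

section \<open>Counting the states\<close>

lemma states_lower_bound: "k ^ h \<le> card (states B)"
proof -
  let ?V = "assignments h k"
  have "eventually (\<lambda>n. \<exists>t. h \<le> card (guessed B v n (state_at v t) {})) sequentially"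
    if v: "v \<in> ?V" for v
  proof -
    obtain e where "query_seq v e = 1" using root_queried[OF v] by blast
    then obtain t where t: "h \<le> card (pebbled h (query_seq v) t)"
      using tree_pebbling_bound[OF h initially_unpebbled[OF v]] by blast
    show ?thesis
      using eventually_pebbled_guessed[OF v, of t]
    proof eventually_elim
      case (elim n)
      show ?case using order_trans[OF t card_mono[OF finite_guessed elim]] by blast
    qed
  qed
  \<comment> \<open>The counting lemma fixes \<open>n\<close>, so one step bound must serve all
    assignments; finiteness of \<open>?V\<close> provides it.\<close>
  then have "eventually (\<lambda>n. \<forall>v\<in>?V. \<exists>t. h \<le> card (guessed B v n (state_at v t) {})) sequentially"
    by (intro eventually_ball_finite) auto
  then obtain n where n: "\<And>v. v \<in> ?V \<Longrightarrow> \<exists>t. h \<le> card (guessed B v n (state_at v t) {})"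
    unfolding eventually_sequentially by blast
  define S where "S q = {v \<in> ?V. (\<forall>j\<in>{}. v j = (0::nat)) \<and>
      (\<forall>t. consistent h k B v ((step_on B v ^^ t) q)) \<and> h \<le> card (guessed B v n q {})}" for q
  have bound: "card (S q) * k ^ h \<le> k ^ (2 ^ h - 1)" for q
    using card_guessing_assignments[of h k "{}" "\<lambda>_. 0" B q h n] h k by (simp add: S_def)
  have fin: "finite (states B)" using program by (simp add: branching_program_def)
  have "?V \<subseteq> (\<Union>q\<in>states B. S q)"
  proof
    fix v assume v: "v \<in> ?V"
    obtain t where t: "h \<le> card (guessed B v n (state_at v t) {})" using n[OF v] by blast
    have "consistent h k B v ((step_on B v ^^ r) (state_at v t))" for r
      using consistent_state_at[OF v, of "r + t"] by (simp add: funpow_add)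
    then have "v \<in> S (state_at v t)" using t v by (simp add: S_def)
    then show "v \<in> (\<Union>q\<in>states B. S q)" using visits_state_at[OF v] by blast
  qed
  then have "card ?V \<le> card (\<Union>q\<in>states B. S q)"
    using fin by (intro card_mono) (auto simp: S_def)
  also have "\<dots> \<le> (\<Sum>q\<in>states B. card (S q))" using fin by (rule card_UN_le)
  \<comment> \<open>The classes \<open>S q\<close> cover all assignments, each with at most a
    fraction \<open>1 / k ^ h\<close> of them; cancelling the number of assignments gives the
    bound.\<close>
  finally have "k ^ (2 ^ h - 1) * k ^ h \<le> (\<Sum>q\<in>states B. card (S q)) * k ^ h"
    unfolding card_assignments by (rule mult_le_mono1)
  also have "\<dots> \<le> (\<Sum>q\<in>states B. k ^ (2 ^ h - 1))"
    unfolding sum_distrib_right by (intro sum_mono bound)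
  finally show ?thesis using k by (simp add: mult.commute)
qed

end

theorem theorem5p10:
  fixes h k :: nat and B :: "('q, tree_var, nat) bp"
  assumes "h \<ge> 2" and "k \<ge> 2"
    and "solves_decision k (tree_vars h k) B (BT h)"
    and "thrifty h k B"
  shows "card (states B) \<ge> k ^ h"
proof -
  interpret thrifty_program h k B by unfold_locales fact+
  show ?thesis by (rule states_lower_bound)
qed

end
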